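(* Let $G=(V,E)$ be a graph, let $v_1,v_2\in V$, and let $k\in\mathbb{N}$. Then: (1) if $v_1$ and $v_2$ are $(k+1)$-locally symmetric, then $v_1$ and $v_2$ are $k$-locally symmetric; (2) if $k\geq \operatorname{diam}(G)$, then $v_1$ and $v_2$ are $k$-locally symmetric if and only if $v_1$ and $v_2$ are globally symmetric.
   Context: Graphs are finite, simple and undirected; the diameter $\operatorname{diam}(G)$ is the largest distance between two vertices of $G$ (infinite if $G$ is disconnected). For a vertex $v$ and $k\in\mathbb{N}$, let $\mathcal{N}^k(v)=\{u\in V : d(u,v)\leq k\}$, where $d$ is graph distance in $G$, and let $\mathcal{N}^k[v]=G[\mathcal{N}^k(v)]$ be the induced subgraph on this set. Two vertices $v_1,v_2\in V$ are $k$-locally symmetric if there is a graph isomorphism $f$ from $\mathcal{N}^k[v_1]$ to $\mathcal{N}^k[v_2]$ with $f(v_1)=v_2$. They are globally symmetric if there is an automorphism $f$ of $G$ with $f(v_1)=v_2$. *)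

theory Defs
  imports "Graph_Theory.Digraph_Isomorphism" "Graph_Theory.Shortest_Path"
begin

text \<open>
  A finite simple undirected graph is an instance of the locale \<^locale>\<open>graph\<close>: a finite digraph
  without loops or parallel arcs whose arc relation is symmetric, so an undirected edge is a pair of
  opposite arcs.
\<close>

definition graph_dist :: "('a, 'b) pre_digraph \<Rightarrow> 'a \<Rightarrow> 'a \<Rightarrow> ereal" where
  "graph_dist G u v = wf_digraph.\<mu> G (\<lambda>_. 1) u v"

definition graph_diam :: "('a, 'b) pre_digraph \<Rightarrow> ereal" where
  "graph_diam G = (SUP u\<in>verts G. SUP v\<in>verts G. graph_dist G u v)"

definition nbhd :: "('a, 'b) pre_digraph \<Rightarrow> nat \<Rightarrow> 'a \<Rightarrow> 'a set" where
  "nbhd G k v = {u \<in> verts G. graph_dist G u v \<le> ereal (real k)}"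

definition nbhd_graph :: "('a, 'b) pre_digraph \<Rightarrow> nat \<Rightarrow> 'a \<Rightarrow> ('a, 'b) pre_digraph" where
  "nbhd_graph G k v = G \<restriction> nbhd G k v"

text \<open>
  A library isomorphism carries an arc map besides the vertex map. Without parallel arcs it is
  determined by the vertex map (lemma \<open>rooted_iso_iff\<close> below).
\<close>

definition rooted_iso ::
    "('a, 'b) pre_digraph \<Rightarrow> 'a \<Rightarrow> ('c, 'd) pre_digraph \<Rightarrow> 'c \<Rightarrow> bool" where
  "rooted_iso G u H v \<longleftrightarrow>
     (\<exists>f. pre_digraph.digraph_isomorphism G f \<and> app_iso f G = H \<and> iso_verts f u = v)"

definition locally_symmetric :: "('a, 'b) pre_digraph \<Rightarrow> nat \<Rightarrow> 'a \<Rightarrow> 'a \<Rightarrow> bool" where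
  "locally_symmetric G k v\<^sub>1 v\<^sub>2 \<longleftrightarrow>
     rooted_iso (nbhd_graph G k v\<^sub>1) v\<^sub>1 (nbhd_graph G k v\<^sub>2) v\<^sub>2"

definition globally_symmetric :: "('a, 'b) pre_digraph \<Rightarrow> 'a \<Rightarrow> 'a \<Rightarrow> bool" where
  "globally_symmetric G v\<^sub>1 v\<^sub>2 \<longleftrightarrow> rooted_iso G v\<^sub>1 G v\<^sub>2"

lemma rooted_iso_iff:
  fixes G :: "('a, 'b) pre_digraph" and H :: "('c, 'd) pre_digraph"
  assumes G: "nomulti_digraph G" and H: "nomulti_digraph H"
  shows "rooted_iso G u H v \<longleftrightarrow>
    (\<exists>f. bij_betw f (verts G) (verts H) \<and>
         (\<forall>x\<in>verts G. \<forall>y\<in>verts G. x \<rightarrow>\<^bsub>G\<^esub> y \<longleftrightarrow> f x \<rightarrow>\<^bsub>H\<^esub> f y) \<and> f u = v)"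
    (is "?L \<longleftrightarrow> (\<exists>f. ?R f)")
proof
  interpret G: nomulti_digraph G by (rule G)
  interpret H: nomulti_digraph H by (rule H)
  {
    assume ?L
    then obtain h where h: "G.digraph_isomorphism h" "app_iso h G = H" "iso_verts h u = v"
      by (auto simp: rooted_iso_def)
    have inj: "inj_on (iso_verts h) (verts G)"
      using h(1) by (rule G.digraph_isomorphism_inj_on_verts)
    have img: "iso_verts h ` verts G = verts H" "iso_arcs h ` arcs G = arcs H"
      using h(2) by auto
    have ends: "tail H (iso_arcs h a) = iso_verts h (tail G a)"
        "head H (iso_arcs h a) = iso_verts h (head G a)" if "a \<in> arcs G" for a
      using h(1) that by (auto simp: h(2)[symmetric] G.digraph_isomorphism_def)
    have fwd: "iso_verts h x \<rightarrow>\<^bsub>H\<^esub> iso_verts h y" if "x \<rightarrow>\<^bsub>G\<^esub> y" for x y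
    proof -
      from that obtain a where a: "a \<in> arcs G" "tail G a = x" "head G a = y"
        by (auto simp: arcs_ends_conv)
      have "iso_arcs h a \<in> arcs H" using img(2) a(1) by blast
      from H.dominatesI[OF _ this] show ?thesis using ends[OF a(1)] a by (simp add: arc_to_ends_def)
    qed
    have bwd: "x \<rightarrow>\<^bsub>G\<^esub> y"
      if xy: "x \<in> verts G" "y \<in> verts G" and d: "iso_verts h x \<rightarrow>\<^bsub>H\<^esub> iso_verts h y" for x y
    proof -
      from d obtain b where b: "b \<in> arcs H" "tail H b = iso_verts h x" "head H b = iso_verts h y"
        by (auto simp: arcs_ends_conv)
      from b(1) obtain a0 where a0: "a0 \<in> arcs G" "b = iso_arcs h a0"
        unfolding img(2)[symmetric] by (rule imageE)
      then obtain a where a: "a \<in> arcs G" "iso_verts h (tail G a) = iso_verts h x"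
          "iso_verts h (head G a) = iso_verts h y"
        using ends[OF a0(1)] b(2,3) by simp
      then have "tail G a = x" "head G a = y"
        using inj xy by (auto dest: inj_onD)
      with a(1) show ?thesis by (auto simp: arcs_ends_conv)
    qed
    have "?R (iso_verts h)"
      using inj img(1) fwd bwd h(3) unfolding bij_betw_def by blast
    then show "\<exists>f. ?R f" by blast
  }
  {
    assume "\<exists>f. ?R f"
    then obtain f where f: "bij_betw f (verts G) (verts H)"
        "\<And>x y. x \<in> verts G \<Longrightarrow> y \<in> verts G \<Longrightarrow> x \<rightarrow>\<^bsub>G\<^esub> y \<longleftrightarrow> f x \<rightarrow>\<^bsub>H\<^esub> f y" "f u = v"
      by blast
    have inj: "inj_on f (verts G)" and img: "f ` verts G = verts H"
      using f(1) by (auto simp: bij_betw_def)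
    define P where "P a b \<longleftrightarrow> b \<in> arcs H \<and> tail H b = f (tail G a) \<and> head H b = f (head G a)" for a b
    define g where "g a = (SOME b. P a b)" for a
    have "\<exists>b. P a b" if "a \<in> arcs G" for a
    proof -
      have "tail G a \<rightarrow>\<^bsub>G\<^esub> head G a" using that by (auto simp: arcs_ends_conv)
      then have "f (tail G a) \<rightarrow>\<^bsub>H\<^esub> f (head G a)" using f(2) that by simp
      then show ?thesis by (auto simp: P_def arcs_ends_conv)
    qed
    then have g: "P a (g a)" if "a \<in> arcs G" for a
      unfolding g_def using that by (metis someI_ex)
    have inj_g: "inj_on g (arcs G)"
    proof (rule inj_onI)
      fix a b assume ab: "a \<in> arcs G" "b \<in> arcs G" "g a = g b"
      then have "f (tail G a) = f (tail G b)" "f (head G a) = f (head G b)"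
        using g[OF ab(1)] g[OF ab(2)] by (simp_all add: P_def)
      then have "tail G a = tail G b" "head G a = head G b"
        using inj ab(1,2) by (auto dest: inj_onD)
      then show "a = b" using G.no_multi_arcs ab by (simp add: arc_to_ends_def)
    qed
    have img_g: "g ` arcs G = arcs H"
    proof (intro equalityI subsetI)
      fix b assume "b \<in> g ` arcs G" then show "b \<in> arcs H" using g by (auto simp: P_def)
    next
      fix b assume b: "b \<in> arcs H"
      then obtain x y where xy: "x \<in> verts G" "y \<in> verts G" "tail H b = f x" "head H b = f y"
        using H.tail_in_verts[OF b] H.head_in_verts[OF b] unfolding img[symmetric] by (elim imageE)
      have "f x \<rightarrow>\<^bsub>H\<^esub> f y"
        using H.dominatesI[OF _ b, of "f x" "f y"] xy by (simp add: arc_to_ends_def)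
      then have "x \<rightarrow>\<^bsub>G\<^esub> y" using f(2) xy by blast
      then obtain a where a: "a \<in> arcs G" "tail G a = x" "head G a = y"
        by (auto simp: arcs_ends_conv)
      then have "g a = b"
        using g[OF a(1)] b xy H.no_multi_arcs by (simp add: P_def arc_to_ends_def)
      then show "b \<in> g ` arcs G" using a(1) by blast
    qed
    define h where "h = \<lparr>iso_verts = f, iso_arcs = g, iso_head = head H, iso_tail = tail H\<rparr>"
    have "G.digraph_isomorphism h"
      unfolding G.digraph_isomorphism_def h_def
      using inj inj_g g by (auto simp: P_def G.wf_digraph)
    moreover have "app_iso h G = H"
      by (simp add: app_iso_def h_def img img_g)
    ultimately show ?L
      using f(3) unfolding rooted_iso_def by (intro exI[of _ h]) (simp add: h_def)
  }
qed

end

theory Submission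
  imports Defs
begin

text \<open>
  The ball of radius \<open>k + 1\<close> arises from the ball of radius \<open>k\<close> by adding all vertices with an arc
  into it (lemma \<open>nbhd_Suc_iff\<close>), and the arcs that witness this lie inside the larger ball. So a
  map that fixes the root and preserves the arcs of a ball cannot increase the distance to the root
  (\<open>arc_preserving_map_nbhd\<close>). Applied to an isomorphism of \<open>m\<close>-balls and to its inverse, this shows
  that the isomorphism restricts to a bijection between the concentric \<open>j\<close>-balls for each \<open>j \<le> m\<close>
  (\<open>rooted_iso_nbhd_graph_mono\<close>), which gives the first claim. The second claim holds because a ball
  of radius at least the diameter is the whole graph, so that the two notions of symmetry speak of
  the same isomorphisms.
\<close>

text \<open>
  Distances are infima of extended reals. As walk lengths are natural numbers, an infimum bounded
  by \<open>k\<close> is witnessed by a walk.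
\<close>

lemma (in wf_digraph) nbhd_iff_awalk:
  "u \<in> nbhd G k v \<longleftrightarrow> (\<exists>p. awalk u p v \<and> length p \<le> k)"
proof
  have cost: "awalk_cost (\<lambda>_. 1) p = real (length p)" for p
    by (induction p) simp_all
  {
    assume u: "u \<in> nbhd G k v"
    show "\<exists>p. awalk u p v \<and> length p \<le> k"
    proof (rule ccontr)
      assume "\<not> ?thesis"
      then have "ereal (real (Suc k)) \<le> \<mu> (\<lambda>_. 1) u v"
        unfolding \<mu>_def cost by (intro INF_greatest) (auto simp: not_le Suc_le_eq)
      also have "\<dots> \<le> ereal (real k)"
        using u by (simp add: nbhd_def graph_dist_def)
      finally show False by simp
    qed
  }
  {
    assume "\<exists>p. awalk u p v \<and> length p \<le> k"
    then obtain p where p: "awalk u p v" "length p \<le> k" by blast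
    have "\<mu> (\<lambda>_. 1) u v \<le> ereal (real (length p))"
      using min_cost_le_walk_cost[OF p(1), of "\<lambda>_. 1"] by (simp only: cost)
    also have "\<dots> \<le> ereal (real k)" using p(2) by simp
    finally show "u \<in> nbhd G k v"
      using awalk_hd_in_verts[OF p(1)] by (simp add: nbhd_def graph_dist_def)
  }
qed

lemma (in wf_digraph) nbhd_0:
  "v \<in> verts G \<Longrightarrow> nbhd G 0 v = {v}"
  by (auto simp: nbhd_iff_awalk awalk_Nil_iff)

lemma (in wf_digraph) nbhd_Suc_iff:
  "x \<in> nbhd G (Suc k) v \<longleftrightarrow> x \<in> nbhd G k v \<or> (\<exists>w\<in>nbhd G k v. x \<rightarrow>\<^bsub>G\<^esub> w)"
proof
  assume "x \<in> nbhd G (Suc k) v"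
  then obtain p where p: "awalk x p v" "length p \<le> Suc k"
    by (auto simp: nbhd_iff_awalk)
  show "x \<in> nbhd G k v \<or> (\<exists>w\<in>nbhd G k v. x \<rightarrow>\<^bsub>G\<^esub> w)"
  proof (cases p)
    case Nil
    then show ?thesis using p(1) by (auto simp: nbhd_iff_awalk)
  next
    case (Cons e es)
    then have "e \<in> arcs G" "x = tail G e" "head G e \<in> nbhd G k v"
      using p by (auto simp: nbhd_iff_awalk awalk_Cons_iff)
    then show ?thesis by (auto simp: arcs_ends_conv)
  qed
next
  assume "x \<in> nbhd G k v \<or> (\<exists>w\<in>nbhd G k v. x \<rightarrow>\<^bsub>G\<^esub> w)"
  then show "x \<in> nbhd G (Suc k) v"
  proof (elim disjE bexE)
    assume "x \<in> nbhd G k v"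
    then show ?thesis by (auto simp: nbhd_iff_awalk intro: le_SucI)
  next
    fix w assume w: "w \<in> nbhd G k v" "x \<rightarrow>\<^bsub>G\<^esub> w"
    from w(2) obtain e where e: "e \<in> arcs G" "tail G e = x" "head G e = w"
      by (auto simp: arcs_ends_conv)
    from w(1) obtain p where "awalk w p v" "length p \<le> k"
      by (auto simp: nbhd_iff_awalk)
    with e have "awalk x (e # p) v" "length (e # p) \<le> Suc k"
      by (auto simp: awalk_Cons_iff)
    then show ?thesis unfolding nbhd_iff_awalk by blast
  qed
qed

lemma (in wf_digraph) nbhd_mono:
  "j \<le> k \<Longrightarrow> nbhd G j v \<subseteq> nbhd G k v"
  unfolding subset_iff nbhd_iff_awalk by (meson order_trans)

text \<open>
  The image of a shortest walk to the root is a walk of the same length. Induction on the radius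
  expresses this through \<open>nbhd_Suc_iff\<close>, without mapping walks; the radius must stay at most \<open>m\<close>
  because \<open>f\<close> is controlled on the \<open>m\<close>-ball only.
\<close>

lemma arc_preserving_map_nbhd:
  assumes "wf_digraph G" and "wf_digraph H" and "u \<in> verts G" and "v \<in> verts H"
    and root: "f u = v"
    and arcs: "\<And>x y. x \<in> nbhd G m u \<Longrightarrow> y \<in> nbhd G m u \<Longrightarrow> x \<rightarrow>\<^bsub>G\<^esub> y \<Longrightarrow> f x \<rightarrow>\<^bsub>H\<^esub> f y"
    and "j \<le> m" and "x \<in> nbhd G j u"
  shows "f x \<in> nbhd H j v"
proof -
  interpret G: wf_digraph G by fact
  interpret H: wf_digraph H by fact
  show ?thesis
    using \<open>j \<le> m\<close> \<open>x \<in> nbhd G j u\<close>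
  proof (induction j arbitrary: x)
    case 0
    then show ?case using assms(3,4) root by (simp add: G.nbhd_0 H.nbhd_0)
  next
    case (Suc j)
    from Suc.prems(2) consider
        "x \<in> nbhd G j u" | w where "w \<in> nbhd G j u" "x \<rightarrow>\<^bsub>G\<^esub> w"
      unfolding G.nbhd_Suc_iff by blast
    then show ?case
    proof cases
      case 1
      then show ?thesis using Suc unfolding H.nbhd_Suc_iff by simp
    next
      case 2
      have "x \<in> nbhd G m u" "w \<in> nbhd G m u"
        using Suc.prems 2(1) G.nbhd_mono[of "Suc j" m u] G.nbhd_mono[of j m u] by auto
      then have "f x \<rightarrow>\<^bsub>H\<^esub> f w" using arcs 2(2) by blast
      moreover have "f w \<in> nbhd H j v" using Suc 2(1) by simp
      ultimately show ?thesis unfolding H.nbhd_Suc_iff by blast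
    qed
  qed
qed

lemma verts_nbhd_graph [simp]:
  "verts (nbhd_graph G k v) = nbhd G k v"
  by (simp add: nbhd_graph_def)

lemma dominates_nbhd_graph_iff:
  "x \<rightarrow>\<^bsub>nbhd_graph G k v\<^esub> y \<longleftrightarrow> x \<in> nbhd G k v \<and> y \<in> nbhd G k v \<and> x \<rightarrow>\<^bsub>G\<^esub> y"
  by (auto simp: nbhd_graph_def arcs_ends_conv)

lemma (in nomulti_digraph) nomulti_digraph_nbhd_graph:
  "nomulti_digraph (nbhd_graph G k v)"
proof -
  interpret N: wf_digraph "nbhd_graph G k v"
    unfolding nbhd_graph_def by (rule wellformed_induce_subgraph)
  show ?thesis
    by unfold_locales (auto simp: nbhd_graph_def arc_to_ends_def intro: no_multi_arcs)
qed

text \<open>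
  Both an isomorphism and its inverse are arc-preserving and respect the roots, so neither increases
  the distance to the root. Hence the isomorphism preserves this distance and carries smaller balls
  onto smaller balls.
\<close>

lemma rooted_iso_nbhd_graph_mono:
  assumes G: "nomulti_digraph G" and H: "nomulti_digraph H"
    and u: "u \<in> verts G" and v: "v \<in> verts H" and "j \<le> m"
    and iso: "rooted_iso (nbhd_graph G m u) u (nbhd_graph H m v) v"
  shows "rooted_iso (nbhd_graph G j u) u (nbhd_graph H j v) v"
proof -
  interpret G: nomulti_digraph G by fact
  interpret H: nomulti_digraph H by fact
  note rooted_iso_nbhd_iff = rooted_iso_iff[OF G.nomulti_digraph_nbhd_graph H.nomulti_digraph_nbhd_graph]
  have sub: "nbhd G j u \<subseteq> nbhd G m u" "nbhd H j v \<subseteq> nbhd H m v"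
    using \<open>j \<le> m\<close> by (rule G.nbhd_mono, rule H.nbhd_mono)
  have root: "u \<in> nbhd G m u"
    using G.nbhd_mono[of 0 m u] G.nbhd_0[OF u] by simp
  from iso obtain f where f: "bij_betw f (nbhd G m u) (nbhd H m v)" "f u = v"
    and dom: "\<And>x y. x \<in> nbhd G m u \<Longrightarrow> y \<in> nbhd G m u \<Longrightarrow> x \<rightarrow>\<^bsub>G\<^esub> y \<longleftrightarrow> f x \<rightarrow>\<^bsub>H\<^esub> f y"
    unfolding rooted_iso_nbhd_iff verts_nbhd_graph dominates_nbhd_graph_iff
    by (metis bij_betwE)
  define g where "g = inv_into (nbhd G m u) f"
  have fg: "f (g y) = y" "g y \<in> nbhd G m u" if "y \<in> nbhd H m v" for y
    using f(1) that unfolding g_def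
    by (simp_all add: bij_betw_inv_into_right bij_betw_apply[OF bij_betw_inv_into])
  have gf: "g (f x) = x" if "x \<in> nbhd G m u" for x
    using f(1) that unfolding g_def by (rule bij_betw_inv_into_left)
  have f_ball: "f x \<in> nbhd H j v" if "x \<in> nbhd G j u" for x
    using G.wf_digraph H.wf_digraph u v f(2) _ \<open>j \<le> m\<close> that
    by (rule arc_preserving_map_nbhd[where m = m]) (use dom in blast)
  have g_ball: "g y \<in> nbhd G j u" if "y \<in> nbhd H j v" for y
    using H.wf_digraph G.wf_digraph v u _ _ \<open>j \<le> m\<close> that
  proof (rule arc_preserving_map_nbhd[where m = m])
    show "g v = u" using gf[OF root] f(2) by simp
    show "g x \<rightarrow>\<^bsub>G\<^esub> g y" if "x \<in> nbhd H m v" "y \<in> nbhd H m v" "x \<rightarrow>\<^bsub>H\<^esub> y" for x y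
      using dom fg that by simp
  qed
  have "bij_betw f (nbhd G j u) (nbhd H j v)"
    by (rule bij_betw_byWitness[where f' = g]) (use f_ball g_ball fg gf sub in auto)
  then show ?thesis
    unfolding rooted_iso_nbhd_iff verts_nbhd_graph dominates_nbhd_graph_iff
    using f(2) dom f_ball sub(1) by (intro exI[of _ f]) blast
qed

lemma nbhd_eq_verts:
  assumes "v \<in> verts G" and "graph_diam G \<le> ereal (real k)"
  shows "nbhd G k v = verts G"
proof -
  have "graph_dist G u v \<le> ereal (real k)" if "u \<in> verts G" for u
    using assms that unfolding graph_diam_def SUP_le_iff by blast
  then show ?thesis by (auto simp: nbhd_def)
qed

lemma (in wf_digraph) nbhd_graph_eq:
  assumes "v \<in> verts G" and "graph_diam G \<le> ereal (real k)"
  shows "nbhd_graph G k v = G"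
  unfolding nbhd_graph_def nbhd_eq_verts[OF assms]
  by (rule pre_digraph.equality) auto

theorem proposition2p5:
  fixes G :: "('a, 'b) pre_digraph" and v\<^sub>1 v\<^sub>2 :: 'a and k :: nat
  assumes "graph G" and "v\<^sub>1 \<in> verts G" and "v\<^sub>2 \<in> verts G"
  shows "(locally_symmetric G (k + 1) v\<^sub>1 v\<^sub>2 \<longrightarrow> locally_symmetric G k v\<^sub>1 v\<^sub>2) \<and>
    (graph_diam G \<le> ereal (real k) \<longrightarrow>
      (locally_symmetric G k v\<^sub>1 v\<^sub>2 \<longleftrightarrow> globally_symmetric G v\<^sub>1 v\<^sub>2))"
proof -
  interpret graph G by fact
  show ?thesis
    using rooted_iso_nbhd_graph_mono[OF nomulti_digraph nomulti_digraph assms(2,3), of k "k + 1"]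
      nbhd_graph_eq[OF assms(2)] nbhd_graph_eq[OF assms(3)]
    by (simp add: locally_symmetric_def globally_symmetric_def)
qed

end
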